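(* Let $n=2k$ or $n=2k+1$, let $q\in\mathbb{C}\setminus\{0\}$ be not a root of unity, and let $T$ be a finite dimensional irreducible representation of $U'_q({\rm so}_n)$ of the classical type or of the nonclassical type. Let $|{\bf m}\rangle$ be a weight vector of $T$ of weight ${\bf m}=(m_1,\dots,m_k)$. Then, for $i=1,\dots,k$, the raising and lowering operators $R^{\bf m}_{\alpha_i}$, $L^{\bf m}_{\alpha_i}$ defined in the context for the corresponding type satisfy $$R^{\bf m}_{\alpha_i}|{\bf m}\rangle=\beta_i\,|{\bf m}+\alpha_i\rangle,\qquad L^{\bf m}_{\alpha_i}|{\bf m}\rangle=\gamma_i\,|{\bf m}-\alpha_i\rangle,$$ where $|{\bf m}\pm\alpha_i\rangle$ denotes a weight vector of weight ${\bf m}\pm\alpha_i$ and $\beta_i,\gamma_i$ are complex numbers, which depend on the representation.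
   Context: $U'_q({\rm so}_n)$ is the complex unital associative algebra generated by $I_{21},I_{32},\dots,I_{n,n-1}$ with relations $I_{i,i-1}^2I_{i+1,i}-(q+q^{-1})I_{i,i-1}I_{i+1,i}I_{i,i-1}+I_{i+1,i}I_{i,i-1}^2=-I_{i+1,i}$, $I_{i,i-1}I_{i+1,i}^2-(q+q^{-1})I_{i+1,i}I_{i,i-1}I_{i+1,i}+I_{i+1,i}^2I_{i,i-1}=-I_{i,i-1}$, and $I_{i,i-1}I_{j,j-1}=I_{j,j-1}I_{i,i-1}$ for $|i-j|>1$. Fractional powers of $q$ are powers of a fixed root of $q$. For $a>l+1$ define recursively $I_{al}=q^{1/2}I_{l+1,l}I_{a,l+1}-q^{-1/2}I_{a,l+1}I_{l+1,l}$. Representations are on complex vector spaces. Put $[m]_q=\frac{q^m-q^{-m}}{q-q^{-1}}$ and $[m]_+=\frac{q^m+q^{-m}}{q-q^{-1}}$. An irreducible finite dimensional representation $T$ is of the classical type if the operators $T(I_{2j,2j-1})$, $j=1,\dots,k$, have eigenvalues of the form ${\rm i}[m]_q$, $m\in\frac12\mathbb{Z}$, and of the nonclassical type if they have eigenvalues of the form $[m]_+$, $m\in\frac12\mathbb{Z}$, $m\notin\mathbb{Z}$. A weight vector is a common eigenvector of the operators $T(I_{2j,2j-1})$, $j=1,\dots,k$; it has weight ${\bf m}=(m_1,\dots,m_k)$ if the eigenvalue of $T(I_{2j,2j-1})$ on it is ${\rm i}[m_j]_q$ (classical type), respectively $[m_j]_+$ (nonclassical type). $\alpha_1,\dots,\alpha_k$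 are the simple roots of ${\rm so}(n,\mathbb{C})$: with $e_1,\dots,e_k$ the standard basis, $\alpha_i=e_i-e_{i+1}$ for $i=1,\dots,k-1$; $\alpha_k=e_{k-1}+e_k$ if $n=2k$; $\alpha_k=e_k$ if $n=2k+1$. Classical type. For $i=1,\dots,k-1$: $$R^{\bf m}_{\alpha_i}=-T(I_{2i+2,2i-1})+q^{-(m_i+m_{i+1})/2}T(I_{2i+1,2i})-{\rm i}q^{-m_i+1/2}T(I_{2i+2,2i})-{\rm i}q^{-m_{i+1}-1/2}T(I_{2i+1,2i-1}),$$ $$L^{\bf m}_{\alpha_i}=-T(I_{2i+2,2i-1})+q^{(m_i+m_{i+1})/2}T(I_{2i+1,2i})+{\rm i}q^{m_i+1/2}T(I_{2i+2,2i})+{\rm i}q^{m_{i+1}-1/2}T(I_{2i+1,2i-1}).$$ If $n=2k$: $$R^{\bf m}_{\alpha_k}=T(I_{2k,2k-3})+q^{(-m_{k-1}+m_k)/2}T(I_{2k-1,2k-2})+{\rm i}q^{-m_{k-1}+1/2}T(I_{2k,2k-2})-{\rm i}q^{m_k-1/2}T(I_{2k-1,2k-3}),$$ $$L^{\bf m}_{\alpha_k}=-T(I_{2k,2k-3})+q^{(m_{k-1}-m_k)/2}T(I_{2k-1,2k-2})+{\rm i}q^{m_{k-1}+1/2}T(I_{2k,2k-2})+{\rm i}q^{-m_k-1/2}T(I_{2k-1,2k-3}).$$ If $n=2k+1$: $$R^{\bf m}_{\alpha_k}=T(I_{2k+1,2k-1})+{\rm i}q^{-m_k+1/2}T(I_{2k+1,2k}),\qquad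 L^{\bf m}_{\alpha_k}=T(I_{2k+1,2k-1})-{\rm i}q^{m_k+1/2}T(I_{2k+1,2k}).$$ Nonclassical type. For $i=1,\dots,k-1$: $$R^{\bf m}_{\alpha_i}=-T(I_{2i+2,2i-1})+q^{-(m_i+m_{i+1})/2}T(I_{2i+1,2i})-q^{-m_i+1/2}T(I_{2i+2,2i})-q^{-m_{i+1}-1/2}T(I_{2i+1,2i-1}),$$ $$L^{\bf m}_{\alpha_i}=-T(I_{2i+2,2i-1})+q^{(m_i+m_{i+1})/2}T(I_{2i+1,2i})-q^{m_i+1/2}T(I_{2i+2,2i})-q^{m_{i+1}-1/2}T(I_{2i+1,2i-1}).$$ If $n=2k$: $$R^{\bf m}_{\alpha_k}=T(I_{2k,2k-3})+q^{(-m_{k-1}+m_k)/2}T(I_{2k-1,2k-2})+q^{-m_{k-1}+1/2}T(I_{2k,2k-2})+q^{m_k-1/2}T(I_{2k-1,2k-3}),$$ $$L^{\bf m}_{\alpha_k}=-T(I_{2k,2k-3})-q^{(m_{k-1}-m_k)/2}T(I_{2k-1,2k-2})+q^{m_{k-1}+1/2}T(I_{2k,2k-2})+q^{-m_k-1/2}T(I_{2k-1,2k-3}).$$ If $n=2k+1$: $$R^{\bf m}_{\alpha_k}=T(I_{2k+1,2k-1})+q^{-m_k+1/2}T(I_{2k+1,2k}),\qquad L^{\bf m}_{\alpha_k}=T(I_{2k+1,2k-1})-q^{m_k+1/2}T(I_{2k+1,2k}).$$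
   Formalization: R, L corrected: exponents of q at I_{2i+1,2i}, I_{2k-1,2k-2} doubled; signs flipped in classical n=2k L_{α_k} (terms 2,4), nonclassical R,L for i<k (term 1), n=2k R_{α_k} (terms 3,4), n=2k+1 R_{α_k} (term 2). n≥3; β,γ may be 0 if m±α is not a weight. *)

theory Defs
  imports Complex_Main "HOL-Library.Poly_Mapping" "HOL-Algebra.QuotRing"
begin

text \<open>Words in the letters \<open>i\<close> (the letter \<open>i\<close> stands for the generator \<open>I\<^bsub>i,i-1\<^esub>\<close>), with concatenation
  written additively, so that \<open>gword \<Rightarrow>\<^sub>0 complex\<close> with the convolution product of
  \<^theory>\<open>HOL-Library.Poly_Mapping\<close> is the algebra of noncommutative polynomials.\<close>

datatype gword = Word (letters: "nat list")

instantiation gword :: monoid_add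
begin

definition zero_gword :: gword where
  "zero_gword = Word []"

definition plus_gword :: "gword \<Rightarrow> gword \<Rightarrow> gword" where
  "plus_gword u v = Word (letters u @ letters v)"

instance
  by standard (auto simp: zero_gword_def plus_gword_def)

end

type_synonym ncpoly = "gword \<Rightarrow>\<^sub>0 complex"

abbreviation cst :: "complex \<Rightarrow> ncpoly" where
  "cst c \<equiv> Poly_Mapping.single 0 c"

abbreviation gen :: "nat \<Rightarrow> ncpoly" where
  "gen i \<equiv> Poly_Mapping.single (Word [i]) 1"

definition free_algebra :: "nat \<Rightarrow> ncpoly ring" where
  "free_algebra n =
     \<lparr>carrier = {p. \<forall>w \<in> Poly_Mapping.keys p. set (letters w) \<subseteq> {2..n}},
      mult = (*), one = 1, zero = 0, add = (+)\<rparr>"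

lemma free_algebra_ring: "ring (free_algebra n)"
proof -
  define C where "C = {p :: ncpoly. \<forall>w \<in> Poly_Mapping.keys p. set (letters w) \<subseteq> {2..n}}"
  have add: "x + y \<in> C" if "x \<in> C" "y \<in> C" for x y
    using that Poly_Mapping.keys_add[of x y] unfolding C_def by blast
  have neg: "- x \<in> C" if "x \<in> C" for x
    using that unfolding C_def by simp
  have mult: "x * y \<in> C" if "x \<in> C" "y \<in> C" for x y
  proof -
    have "set (letters w) \<subseteq> {2..n}" if w: "w \<in> Poly_Mapping.keys (x * y)" for w
    proof -
      obtain a b where "w = a + b" "a \<in> Poly_Mapping.keys x" "b \<in> Poly_Mapping.keys y"
        using w Poly_Mapping.keys_mult[of x y] by blast
      then show ?thesis
        using \<open>x \<in> C\<close> \<open>y \<in> C\<close> by (simp add: C_def plus_gword_def)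
    qed
    then show ?thesis
      by (simp add: C_def)
  qed
  have zero: "0 \<in> C" and one: "1 \<in> C"
    by (simp_all add: C_def zero_gword_def)
  have eq: "free_algebra n = \<lparr>carrier = C, mult = (*), one = 1, zero = 0, add = (+)\<rparr>"
    by (simp add: free_algebra_def C_def)
  show ?thesis
    unfolding eq
  proof (rule ringI, goal_cases)
    case 1
    show ?case
      by (rule abelian_groupI)
        (use add zero neg in \<open>auto simp: add.assoc add.commute intro!: bexI[of _ "- _"]\<close>)
  next
    case 2
    show ?case
      by (rule monoidI) (use mult one in \<open>auto simp: mult.assoc\<close>)
  qed (simp_all add: distrib_left distrib_right)
qed

definition uqso_relations :: "nat \<Rightarrow> complex \<Rightarrow> ncpoly set" where
  "uqso_relations n q =
     (\<Union>i\<in>{2..<n}.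
        {gen i * gen i * gen (i+1) - cst (q + inverse q) * (gen i * gen (i+1) * gen i)
           + gen (i+1) * gen i * gen i + gen (i+1),
         gen i * gen (i+1) * gen (i+1) - cst (q + inverse q) * (gen (i+1) * gen i * gen (i+1))
           + gen (i+1) * gen (i+1) * gen i + gen i})
     \<union> {gen i * gen j - gen j * gen i | i j.
          i \<in> {2..n} \<and> j \<in> {2..n} \<and> \<bar>int i - int j\<bar> > 1}"

definition uqso_ideal :: "nat \<Rightarrow> complex \<Rightarrow> ncpoly set" where
  "uqso_ideal n q = Idl\<^bsub>free_algebra n\<^esub> (uqso_relations n q)"

text \<open>The algebra \<open>U'\<^sub>q(so\<^sub>n)\<close>, and the residue class of a noncommutative polynomial in it.\<close>

definition uqso :: "nat \<Rightarrow> complex \<Rightarrow> ncpoly set ring" where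
  "uqso n q = free_algebra n Quot uqso_ideal n q"

definition uqso_class :: "nat \<Rightarrow> complex \<Rightarrow> ncpoly \<Rightarrow> ncpoly set" where
  "uqso_class n q p = uqso_ideal n q +>\<^bsub>free_algebra n\<^esub> p"

text \<open>\<open>r\<close> is a fixed square root of \<open>q\<close>, and \<open>qpow r x\<close> is \<open>q\<^sup>x\<close> for \<open>x\<close> in \<open>\<onehalf>\<int>\<close>; it is not meant for
  other arguments.\<close>

definition half_ints :: "rat set" where
  "half_ints = {x. 2 * x \<in> \<int>}"

definition qpow :: "complex \<Rightarrow> rat \<Rightarrow> complex" where
  "qpow r x = r powi \<lfloor>2 * x\<rfloor>"

definition qnum :: "complex \<Rightarrow> rat \<Rightarrow> complex" where
  "qnum r m = (qpow r m - qpow r (- m)) / (qpow r 1 - qpow r (- 1))"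

definition qnum_plus :: "complex \<Rightarrow> rat \<Rightarrow> complex" where
  "qnum_plus r m = (qpow r m + qpow r (- m)) / (qpow r 1 - qpow r (- 1))"

text \<open>Polynomial representing \<open>I\<^bsub>al\<^esub>\<close>, for \<open>1 \<le> l < a \<le> n\<close>.\<close>

function Ipoly :: "complex \<Rightarrow> nat \<Rightarrow> nat \<Rightarrow> ncpoly" where
  "Ipoly r a l =
     (if a \<le> l + 1 then gen a
      else cst (qpow r (1/2)) * (gen (l+1) * Ipoly r a (l+1))
           - cst (qpow r (- 1/2)) * (Ipoly r a (l+1) * gen (l+1)))"
  by auto
termination
  by (relation "measure (\<lambda>(r, a, l). a - l)") auto

declare Ipoly.simps [simp del]

definition Iel :: "nat \<Rightarrow> complex \<Rightarrow> complex \<Rightarrow> nat \<Rightarrow> nat \<Rightarrow> ncpoly set" where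
  "Iel n q r a l = uqso_class n q (Ipoly r a l)"

text \<open>Below, the underlying space of a representation is the whole type \<open>'v\<close>, with
  multiplication by complex numbers \<open>scale\<close>.\<close>

definition End :: "(complex \<Rightarrow> 'v \<Rightarrow> 'v) \<Rightarrow> ('v::ab_group_add \<Rightarrow> 'v) ring" where
  "End scale =
     \<lparr>carrier = {f. Vector_Spaces.linear scale scale f},
      mult = (\<circ>), one = id, zero = (\<lambda>_. 0), add = (\<lambda>f g v. f v + g v)\<rparr>"

definition finite_dim :: "(complex \<Rightarrow> 'v::ab_group_add \<Rightarrow> 'v) \<Rightarrow> bool" where
  "finite_dim scale \<longleftrightarrow> (\<exists>B. finite B \<and> module.span scale B = UNIV)"

definition representation ::
  "nat \<Rightarrow> complex \<Rightarrow> (complex \<Rightarrow> 'v::ab_group_add \<Rightarrow> 'v) \<Rightarrow> (ncpoly set \<Rightarrow> 'v \<Rightarrow> 'v) \<Rightarrow> bool" where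
  "representation n q scale T \<longleftrightarrow>
     T \<in> ring_hom (uqso n q) (End scale) \<and>
     (\<forall>c. \<forall>p \<in> carrier (free_algebra n). \<forall>v.
        T (uqso_class n q (cst c * p)) v = scale c (T (uqso_class n q p) v))"

definition irreducible_rep ::
  "nat \<Rightarrow> complex \<Rightarrow> (complex \<Rightarrow> 'v::ab_group_add \<Rightarrow> 'v) \<Rightarrow> (ncpoly set \<Rightarrow> 'v \<Rightarrow> 'v) \<Rightarrow> bool" where
  "irreducible_rep n q scale T \<longleftrightarrow>
     representation n q scale T \<and> (UNIV :: 'v set) \<noteq> {0} \<and>
     (\<forall>W. module.subspace scale W \<and> (\<forall>x \<in> carrier (uqso n q). T x ` W \<subseteq> W) \<longrightarrow>
        W = {0} \<or> W = UNIV)"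

datatype rep_type = Classical | Nonclassical

fun eigval :: "rep_type \<Rightarrow> complex \<Rightarrow> rat \<Rightarrow> complex" where
  "eigval Classical r m = \<i> * qnum r m"
| "eigval Nonclassical r m = qnum_plus r m"

fun weight_coords :: "rep_type \<Rightarrow> rat set" where
  "weight_coords Classical = half_ints"
| "weight_coords Nonclassical = half_ints - \<int>"

definition is_eigenvector ::
  "(complex \<Rightarrow> 'v::ab_group_add \<Rightarrow> 'v) \<Rightarrow> ('v \<Rightarrow> 'v) \<Rightarrow> complex \<Rightarrow> 'v \<Rightarrow> bool" where
  "is_eigenvector scale f c v \<longleftrightarrow> v \<noteq> 0 \<and> f v = scale c v"

definition of_type ::
  "rep_type \<Rightarrow> nat \<Rightarrow> complex \<Rightarrow> complex \<Rightarrow> (complex \<Rightarrow> 'v::ab_group_add \<Rightarrow> 'v) \<Rightarrow>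
     (ncpoly set \<Rightarrow> 'v \<Rightarrow> 'v) \<Rightarrow> bool" where
  "of_type ty n q r scale T \<longleftrightarrow>
     (\<forall>j \<in> {1..n div 2}. \<forall>c v. is_eigenvector scale (T (Iel n q r (2*j) (2*j-1))) c v \<longrightarrow>
        (\<exists>m \<in> weight_coords ty. c = eigval ty r m))"

text \<open>Weights are functions on \<open>\<nat>\<close> of which only the values at \<open>1, \<dots>, k\<close> with \<open>k = n div 2\<close> matter.\<close>

definition weight_vector ::
  "rep_type \<Rightarrow> nat \<Rightarrow> complex \<Rightarrow> complex \<Rightarrow> (complex \<Rightarrow> 'v::ab_group_add \<Rightarrow> 'v) \<Rightarrow>
     (ncpoly set \<Rightarrow> 'v \<Rightarrow> 'v) \<Rightarrow> (nat \<Rightarrow> rat) \<Rightarrow> 'v \<Rightarrow> bool" where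
  "weight_vector ty n q r scale T m v \<longleftrightarrow>
     (\<forall>j \<in> {1..n div 2}. m j \<in> weight_coords ty \<and>
        is_eigenvector scale (T (Iel n q r (2*j) (2*j-1))) (eigval ty r (m j)) v)"

definition unit_weight :: "nat \<Rightarrow> nat \<Rightarrow> rat" where
  "unit_weight i j = (if j = i then 1 else 0)"

definition simple_root :: "nat \<Rightarrow> nat \<Rightarrow> nat \<Rightarrow> rat" where
  "simple_root n i =
     (let k = n div 2 in
      if i < k then (\<lambda>j. unit_weight i j - unit_weight (i+1) j)
      else if n = 2*k then (\<lambda>j. unit_weight (k-1) j + unit_weight k j)
      else unit_weight k)"

text \<open>Raising and lowering operators.

  Up to a common factor, the coefficients are determined by the requirement that weight vectors are
  mapped to weight vectors.  With the recursion for \<open>I\<^bsub>al\<^esub>\<close> used here, the formulas in the literature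
  contain misprints, which are corrected below: the coefficient of \<open>I\<^bsub>2i+1,2i\<^esub>\<close> for \<open>i < k\<close> (and of
  \<open>I\<^bsub>2k-1,2k-2\<^esub>\<close> for \<open>n = 2k\<close>) is printed with half of the exponent of \<open>q\<close>, and the following terms
  are printed with the opposite sign.
  \<^item> Classical, \<open>n = 2k\<close>, \<open>L\<close> for \<open>\<alpha>\<^sub>k\<close>: second and fourth term.
  \<^item> Nonclassical, \<open>R\<close> and \<open>L\<close> for \<open>\<alpha>\<^sub>i\<close>, \<open>i < k\<close>: first term.
  \<^item> Nonclassical, \<open>n = 2k\<close>, \<open>R\<close> for \<open>\<alpha>\<^sub>k\<close>: third and fourth term.
  \<^item> Nonclassical, \<open>n = 2k+1\<close>, \<open>R\<close> for \<open>\<alpha>\<^sub>k\<close>: second term.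

  The printed versions fail already in small representations.  For \<open>n = 3\<close>, \<open>I\<^bsub>21\<^esub>\<close> and \<open>I\<^bsub>32\<^esub>\<close> acting as
  the number \<open>[1/2]\<^sub>+ \<noteq> 0\<close> is a one-dimensional representation of the nonclassical type, in which
  \<open>I\<^bsub>31\<^esub> + q\<^sup>0 I\<^bsub>32\<^esub> = 2 [1/2]\<^sub>+ \<noteq> 0\<close>, although the weight \<open>3/2\<close> does not occur; \<open>I\<^bsub>31\<^esub> - q\<^sup>0 I\<^bsub>32\<^esub>\<close> is zero.\<close>

definition raising_op ::
  "rep_type \<Rightarrow> nat \<Rightarrow> complex \<Rightarrow> complex \<Rightarrow> (complex \<Rightarrow> 'v::ab_group_add \<Rightarrow> 'v) \<Rightarrow>
     (ncpoly set \<Rightarrow> 'v \<Rightarrow> 'v) \<Rightarrow> (nat \<Rightarrow> rat) \<Rightarrow> nat \<Rightarrow> 'v \<Rightarrow> 'v" where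
  "raising_op ty n q r scale T m i v =
     (let k = n div 2; TI = (\<lambda>a l. T (Iel n q r a l) v) in
      case ty of
        Classical \<Rightarrow>
          if i < k then
            - TI (2*i+2) (2*i-1)
            + scale (qpow r (- (m i + m (i+1)))) (TI (2*i+1) (2*i))
            - scale (\<i> * qpow r (- m i + 1/2)) (TI (2*i+2) (2*i))
            - scale (\<i> * qpow r (- m (i+1) - 1/2)) (TI (2*i+1) (2*i-1))
          else if n = 2*k then
            TI (2*k) (2*k-3)
            + scale (qpow r (- m (k-1) + m k)) (TI (2*k-1) (2*k-2))
            + scale (\<i> * qpow r (- m (k-1) + 1/2)) (TI (2*k) (2*k-2))
            - scale (\<i> * qpow r (m k - 1/2)) (TI (2*k-1) (2*k-3))
          else
            TI (2*k+1) (2*k-1)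
            + scale (\<i> * qpow r (- m k + 1/2)) (TI (2*k+1) (2*k))
      | Nonclassical \<Rightarrow>
          if i < k then
            TI (2*i+2) (2*i-1)
            + scale (qpow r (- (m i + m (i+1)))) (TI (2*i+1) (2*i))
            - scale (qpow r (- m i + 1/2)) (TI (2*i+2) (2*i))
            - scale (qpow r (- m (i+1) - 1/2)) (TI (2*i+1) (2*i-1))
          else if n = 2*k then
            TI (2*k) (2*k-3)
            + scale (qpow r (- m (k-1) + m k)) (TI (2*k-1) (2*k-2))
            - scale (qpow r (- m (k-1) + 1/2)) (TI (2*k) (2*k-2))
            - scale (qpow r (m k - 1/2)) (TI (2*k-1) (2*k-3))
          else
            TI (2*k+1) (2*k-1)
            - scale (qpow r (- m k + 1/2)) (TI (2*k+1) (2*k)))"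

definition lowering_op ::
  "rep_type \<Rightarrow> nat \<Rightarrow> complex \<Rightarrow> complex \<Rightarrow> (complex \<Rightarrow> 'v::ab_group_add \<Rightarrow> 'v) \<Rightarrow>
     (ncpoly set \<Rightarrow> 'v \<Rightarrow> 'v) \<Rightarrow> (nat \<Rightarrow> rat) \<Rightarrow> nat \<Rightarrow> 'v \<Rightarrow> 'v" where
  "lowering_op ty n q r scale T m i v =
     (let k = n div 2; TI = (\<lambda>a l. T (Iel n q r a l) v) in
      case ty of
        Classical \<Rightarrow>
          if i < k then
            - TI (2*i+2) (2*i-1)
            + scale (qpow r (m i + m (i+1))) (TI (2*i+1) (2*i))
            + scale (\<i> * qpow r (m i + 1/2)) (TI (2*i+2) (2*i))
            + scale (\<i> * qpow r (m (i+1) - 1/2)) (TI (2*i+1) (2*i-1))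
          else if n = 2*k then
            - TI (2*k) (2*k-3)
            - scale (qpow r (m (k-1) - m k)) (TI (2*k-1) (2*k-2))
            + scale (\<i> * qpow r (m (k-1) + 1/2)) (TI (2*k) (2*k-2))
            - scale (\<i> * qpow r (- m k - 1/2)) (TI (2*k-1) (2*k-3))
          else
            TI (2*k+1) (2*k-1)
            - scale (\<i> * qpow r (m k + 1/2)) (TI (2*k+1) (2*k))
      | Nonclassical \<Rightarrow>
          if i < k then
            TI (2*i+2) (2*i-1)
            + scale (qpow r (m i + m (i+1))) (TI (2*i+1) (2*i))
            - scale (qpow r (m i + 1/2)) (TI (2*i+2) (2*i))
            - scale (qpow r (m (i+1) - 1/2)) (TI (2*i+1) (2*i-1))
          else if n = 2*k then
            - TI (2*k) (2*k-3)
            - scale (qpow r (m (k-1) - m k)) (TI (2*k-1) (2*k-2))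
            + scale (qpow r (m (k-1) + 1/2)) (TI (2*k) (2*k-2))
            + scale (qpow r (- m k - 1/2)) (TI (2*k-1) (2*k-3))
          else
            TI (2*k+1) (2*k-1)
            - scale (qpow r (m k + 1/2)) (TI (2*k+1) (2*k)))"

end

theory Submission
  imports Defs
begin

text \<open>Let \<open>A\<close>, \<open>B\<close>, \<open>C\<close> act as the generators \<open>I\<^bsub>p,p-1\<^esub>\<close>, \<open>I\<^bsub>p+1,p\<^esub>\<close>, \<open>I\<^bsub>p+2,p+1\<^esub>\<close>, let
  \<open>[u] = (u + u\<^sup>-\<^sup>1) / (q - q\<^sup>-\<^sup>1)\<close>, and let \<open>A v = [a] v\<close>, \<open>C v = [b] v\<close>.  The cubic relations turn into
  the quadratic relations \<open>(A - [aq]) (A - [a/q]) B v = 0\<close> and \<open>(C - [bq]) (C - [b/q]) B v = 0\<close>.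
  Since \<open>A\<close> and \<open>C\<close> commute, \<open>(A - [aq]) (C - [b/q]) B v\<close> is zero or a common eigenvector, with
  eigenvalues \<open>[a/q]\<close> and \<open>[bq]\<close>.  Up to sign, the raising and lowering operators are of this form (or
  \<open>r (A - [aq]) B\<close> for the last root of \<open>so\<^bsub>2k+1\<^esub>\<close>), where \<open>a\<close> and \<open>b\<close> are \<open>q\<^sup>m\<close> or its inverse in the
  nonclassical case, and \<open>\<i> q\<^sup>m\<close> or its inverse in the classical case.  The other operators
  \<open>I\<^bsub>2j,2j-1\<^esub>\<close> commute with \<open>A\<close>, \<open>B\<close>, \<open>C\<close>.\<close>

section \<open>Relations in the free algebra, and scalar identities for shifted eigenvalues\<close>

lemma uqso_relations_subset: "uqso_relations n q \<subseteq> carrier (free_algebra n)"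
proof -
  interpret F: ring "free_algebra n" by (rule free_algebra_ring)
  have sel: "mult (free_algebra n) = (*)" "add (free_algebra n) = (+)"
    "zero (free_algebra n) = 0" "one (free_algebra n) = 1"
    by (simp_all add: free_algebra_def)
  have g: "gen j \<in> carrier (free_algebra n)" if "j \<in> {2..n}" for j
    using that by (simp add: free_algebra_def)
  have c: "cst c \<in> carrier (free_algebra n)" for c
    by (simp add: free_algebra_def zero_gword_def)
  have neg: "- x \<in> carrier (free_algebra n)" if "x \<in> carrier (free_algebra n)" for x
    using that by (simp add: free_algebra_def)
  note cl = F.m_closed[unfolded sel] F.a_closed[unfolded sel]
  have diff: "x - y \<in> carrier (free_algebra n)"
    if "x \<in> carrier (free_algebra n)" "y \<in> carrier (free_algebra n)" for x y
    using cl(2)[OF that(1) neg[OF that(2)]] by simp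
  show ?thesis
    unfolding uqso_relations_def by (auto intro!: cl diff g c)
qed

text \<open>The hypothesis is (f - s)(f - t) x = 0. The two factors commute, so f - t kills (f - s)
  x.\<close>

lemma (in vector_space) eigenvector_of_quadratic:
  assumes "Vector_Spaces.linear scale scale f"
    and "f (f x) = scale (s + t) (f x) - scale (s * t) x"
  shows "f (f x - scale s x) = scale t (f x - scale s x)"
proof -
  interpret f: Vector_Spaces.linear scale scale f by fact
  show ?thesis
    by (simp add: f.diff f.scale assms(2) scale_left_distrib scale_right_diff_distrib mult.commute)
qed

text \<open>This is the bracket [u] used above. It covers both types at once: u = q^m gives [m]_+,
  and u = \<i> q^m gives \<i>[m]_q because the inverse of \<i> is -\<i>.\<close>

definition sym_eig :: "complex \<Rightarrow> complex \<Rightarrow> complex" where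
  "sym_eig q u = (u + inverse u) / (q - inverse q)"

lemma sym_eig_inverse: "sym_eig q (inverse u) = sym_eig q u"
  by (simp add: sym_eig_def add.commute)

text \<open>The first two identities give sum and product of the roots [uq] and [u/q] of the
  quadratic relation. The last two are linear in [u]; they turn the coefficients of the root
  operators into shifted eigenvalues.\<close>

lemma sym_eig_shift:
  assumes "q \<noteq> 0" "q\<^sup>2 \<noteq> 1" "u \<noteq> 0"
  shows "sym_eig q (u * q) + sym_eig q (u / q) = (q + inverse q) * sym_eig q u"
    and "sym_eig q (u * q) * sym_eig q (u / q) = (sym_eig q u)\<^sup>2 + 1"
    and "sym_eig q (u * q) = sym_eig q u / q + u"
    and "sym_eig q (u / q) = q * sym_eig q u - u"
proof -
  have "q - inverse q \<noteq> 0"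
    using assms by (simp add: field_simps power2_eq_square)
  define d where "d = q - inverse q"
  have d: "d \<noteq> 0" using \<open>q - inverse q \<noteq> 0\<close> by (simp add: d_def)
  have eq: "sym_eig q x = (x + inverse x) / d" for x by (simp add: sym_eig_def d_def)
  have d2: "d\<^sup>2 = q\<^sup>2 + (inverse q)\<^sup>2 - 2"
    unfolding d_def using assms(1) by (simp add: power2_eq_square algebra_simps)
  show "sym_eig q (u * q) + sym_eig q (u / q) = (q + inverse q) * sym_eig q u"
    unfolding eq using assms d by (simp add: divide_inverse algebra_simps)
  \<comment> \<open>Both sides equal u^2 + u^-2 + q^2 + q^-2. Division by \<open>d\<^sup>2\<close>
    turns the summand \<open>d\<^sup>2\<close> into the constant 1.\<close>
  have "(u * q + inverse (u * q)) * (u / q + inverse (u / q)) = (u + inverse u)\<^sup>2 + d\<^sup>2"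
    unfolding d2 using assms by (simp add: field_simps power2_eq_square)
  then show "sym_eig q (u * q) * sym_eig q (u / q) = (sym_eig q u)\<^sup>2 + 1"
    unfolding eq using d by (simp add: field_simps power2_eq_square)
  have "u * q + inverse (u * q) = (u + inverse u) / q + u * d"
    unfolding d_def using assms by (simp add: field_simps)
  then show "sym_eig q (u * q) = sym_eig q u / q + u"
    unfolding eq using d by (simp add: add_divide_distrib mult.commute)
  have "u / q + inverse (u / q) = q * (u + inverse u) - u * d"
    unfolding d_def using assms by (simp add: field_simps)
  then show "sym_eig q (u / q) = q * sym_eig q u - u"
    unfolding eq using d by (simp add: diff_divide_distrib)
qed

section \<open>The representation as an action of noncommutative polynomials\<close>

locale uqso_rep = vector_space scale
  for scale :: "complex \<Rightarrow> 'v::ab_group_add \<Rightarrow> 'v" +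
  fixes n :: nat and q r :: complex and T :: "ncpoly set \<Rightarrow> 'v \<Rightarrow> 'v"
  assumes rep: "Defs.representation n q scale T"
    and q_nonzero: "q \<noteq> 0" and q_squared: "q\<^sup>2 \<noteq> 1" and r_squared: "r\<^sup>2 = q"
begin

abbreviation "FA \<equiv> carrier (free_algebra n)"

definition act :: "ncpoly \<Rightarrow> 'v \<Rightarrow> 'v" where
  "act p = T (uqso_class n q p)"

lemma FA_closed:
  shows "j \<in> {2..n} \<Longrightarrow> gen j \<in> FA"
    and "x \<in> FA \<Longrightarrow> y \<in> FA \<Longrightarrow> x * y \<in> FA"
    and "x \<in> FA \<Longrightarrow> y \<in> FA \<Longrightarrow> x + y \<in> FA"
    and "x \<in> FA \<Longrightarrow> y \<in> FA \<Longrightarrow> x - y \<in> FA"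
    and "cst c \<in> FA"
proof -
  interpret F: ring "free_algebra n" by (rule free_algebra_ring)
  have sel: "mult (free_algebra n) = (*)" "add (free_algebra n) = (+)"
    by (simp_all add: free_algebra_def)
  show "j \<in> {2..n} \<Longrightarrow> gen j \<in> FA" "cst c \<in> FA"
    by (simp_all add: free_algebra_def zero_gword_def)
  show "x \<in> FA \<Longrightarrow> y \<in> FA \<Longrightarrow> x * y \<in> FA"
    using F.m_closed[unfolded sel] .
  show add: "x \<in> FA \<Longrightarrow> y \<in> FA \<Longrightarrow> x + y \<in> FA" for x y
    using F.a_closed[unfolded sel] .
  show "x \<in> FA \<Longrightarrow> y \<in> FA \<Longrightarrow> x - y \<in> FA"
    using add[of x "- y"] by (simp add: free_algebra_def)
qed

lemma ideal: "ideal (uqso_ideal n q) (free_algebra n)"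
  unfolding uqso_ideal_def
  by (rule ring.genideal_ideal[OF free_algebra_ring uqso_relations_subset])

text \<open>\<open>act\<close> is \<open>T\<close> composed with the quotient map, so sums and
  products of generators can be evaluated without handling cosets.\<close>

lemma act_hom: "act \<in> ring_hom (free_algebra n) (End scale)"
proof -
  have "uqso_class n q \<in> ring_hom (free_algebra n) (uqso n q)"
    using ideal.rcos_ring_hom[OF ideal] unfolding uqso_class_def[abs_def] uqso_def .
  moreover have "T \<in> ring_hom (uqso n q) (End scale)"
    using rep by (simp add: Defs.representation_def)
  ultimately show ?thesis
    using ring_hom_trans[of "uqso_class n q" _ _ T] by (simp add: act_def[abs_def] comp_def)
qed

lemma act_mult: "act (x * y) v = act x (act y v)" if "x \<in> FA" "y \<in> FA"
  using ring_hom_mult[OF act_hom that] by (simp add: free_algebra_def End_def)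

lemma act_add: "act (x + y) v = act x v + act y v" if "x \<in> FA" "y \<in> FA"
  using ring_hom_add[OF act_hom that] by (simp add: free_algebra_def End_def)

lemma linear_act: "Vector_Spaces.linear scale scale (act x)" if "x \<in> FA"
  using ring_hom_closed[OF act_hom that] by (simp add: End_def)

lemma act_cst: "act (cst c) v = scale c v"
proof -
  have one: "1 \<in> FA"
    using FA_closed(5)[of 1] by simp
  \<comment> \<open>A ring homomorphism need not respect complex scalars; the second clause of
    \<open>representation\<close>, taken at the polynomial 1, provides this.\<close>
  have "act (cst c * 1) v = scale c (act 1 v)"
    using rep one unfolding Defs.representation_def act_def by blast
  moreover have "act 1 v = v"
    using ring_hom_one[OF act_hom] by (simp add: free_algebra_def End_def)
  ultimately show ?thesis
    by simp
qed

lemma act_diff: "act (x - y) v = act x v - act y v" if "x \<in> FA" "y \<in> FA"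
  using act_add[of "x - y" y v] FA_closed(4) that by (simp add: algebra_simps)

lemma act_relation: "act x v = 0" if "x \<in> uqso_relations n q"
proof -
  interpret I: ideal "uqso_ideal n q" "free_algebra n" by (rule ideal)
  have "x \<in> uqso_ideal n q"
    unfolding uqso_ideal_def
    using ring.genideal_self[OF free_algebra_ring uqso_relations_subset] that by blast
  then have "uqso_class n q x = uqso_class n q 0"
    using I.a_rcos_const additive_subgroup.zero_closed[OF I.is_additive_subgroup]
    by (simp add: uqso_class_def free_algebra_def)
  then have "act x v = act 0 v"
    by (simp add: act_def)
  also have "act 0 v = 0"
    using act_add[of 0 0 v] by (simp add: free_algebra_def)
  finally show ?thesis .
qed

abbreviation X :: "nat \<Rightarrow> 'v \<Rightarrow> 'v" where
  "X j \<equiv> act (gen j)"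

lemma serre:
  assumes "2 \<le> j" "l = j + 1" "l \<le> n"
  shows "X j (X j (X l v)) - scale (q + inverse q) (X j (X l (X j v)))
           + X l (X j (X j v)) + X l v = 0"
    and "X j (X l (X l v)) - scale (q + inverse q) (X l (X j (X l v)))
           + X l (X l (X j v)) + X j v = 0"
proof -
  have mem: "gen j * gen j * gen l - cst (q + inverse q) * (gen j * gen l * gen j)
      + gen l * gen j * gen j + gen l \<in> uqso_relations n q"
    "gen j * gen l * gen l - cst (q + inverse q) * (gen l * gen j * gen l)
      + gen l * gen l * gen j + gen j \<in> uqso_relations n q"
    unfolding uqso_relations_def assms(2) using assms by auto
  have FA: "gen j \<in> FA" "gen l \<in> FA"
    using assms by (auto intro: FA_closed)
  note F = FA FA_closed(2-5)
  show "X j (X j (X l v)) - scale (q + inverse q) (X j (X l (X j v)))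
           + X l (X j (X j v)) + X l v = 0"
    using act_relation[OF mem(1), of v] F by (simp add: act_mult act_add act_diff act_cst)
  show "X j (X l (X l v)) - scale (q + inverse q) (X l (X j (X l v)))
           + X l (X l (X j v)) + X j v = 0"
    using act_relation[OF mem(2), of v] F by (simp add: act_mult act_add act_diff act_cst)
qed

lemma X_commute:
  assumes "i \<in> {2..n}" "j \<in> {2..n}" "\<bar>int i - int j\<bar> > 1"
  shows "X i (X j v) = X j (X i v)"
proof -
  have "gen i * gen j - gen j * gen i \<in> uqso_relations n q"
    unfolding uqso_relations_def using assms by blast
  from act_relation[OF this, of v] assms show ?thesis
    by (simp add: act_mult act_diff FA_closed(1,2))
qed

lemma linear_X: "Vector_Spaces.linear scale scale (X j)" if "j \<in> {2..n}"
  using linear_act[of "gen j"] FA_closed that by blast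

abbreviation E :: "complex \<Rightarrow> complex" where
  "E \<equiv> sym_eig q"

lemmas E_shift = sym_eig_shift[OF q_nonzero q_squared]

text \<open>On an eigenvector of \<open>X j\<close> the cubic relation of degree two in
  \<open>X j\<close> loses its inner and rightmost factors \<open>X j\<close> to scalars. What
  remains is quadratic in \<open>X j\<close>, with coefficients (q + 1/q)[a] and [a]^2 + 1, the sum
  and product of [aq] and [a/q]. The two cubic relations cover both orders of the neighbours
  \<open>j\<close> and \<open>l\<close>.\<close>

lemma X_quadratic:
  assumes "j \<in> {2..n}" "l \<in> {2..n}" "l = j + 1 \<or> j = l + 1" "a \<noteq> 0" "X j v = scale (E a) v"
  shows "X j (X j (X l v)) =
    scale (E (a * q) + E (a / q)) (X j (X l v)) - scale (E (a * q) * E (a / q)) (X l v)"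
proof -
  interpret j: Vector_Spaces.linear scale scale "X j" by (rule linear_X) fact
  interpret l: Vector_Spaces.linear scale scale "X l" by (rule linear_X) fact
  have "X j (X j (X l v)) - scale (q + inverse q) (X j (X l (X j v)))
           + X l (X j (X j v)) + X l v = 0"
    using assms(1-3) serre(1)[of j l v] serre(2)[of l j v] by (auto simp: algebra_simps)
  then have "X j (X j (X l v)) = scale ((q + inverse q) * E a) (X j (X l v))
      - scale ((E a)\<^sup>2 + 1) (X l v)"
    by (simp add: assms(5) j.scale l.scale scale_left_distrib power2_eq_square add_eq_0_iff
        algebra_simps)
  then show ?thesis
    by (simp only: E_shift(1,2)[OF assms(4)])
qed

section \<open>Root operators expressed through the generators\<close>

definition I :: "nat \<Rightarrow> nat \<Rightarrow> 'v \<Rightarrow> 'v" where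
  "I a l v = T (Iel n q r a l) v"

lemma I_simple: "I (Suc l) l = X (Suc l)"
  by (simp add: I_def[abs_def] Iel_def act_def Ipoly.simps)

lemma I_rec:
  assumes "1 \<le> l" "l + 1 < a" "a \<le> n"
  shows "I a l v = scale r (X (l+1) (I a (l+1) v)) - scale (inverse r) (I a (l+1) (X (l+1) v))"
proof -
  \<comment> \<open>Multiplicativity of \<open>act\<close> holds only on the carrier, so the
    recursively defined polynomials must first be placed there.\<close>
  have FA: "Ipoly r a k \<in> FA" if "1 \<le> k" "k < a" for k
    using that
  proof (induction "a - k" arbitrary: k)
    case (Suc d)
    have "Ipoly r a (k + 1) \<in> FA" if "k + 1 < a"
      using Suc that by auto
    then show ?case
      using Suc.prems assms by (subst Ipoly.simps) (auto intro!: FA_closed)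
  qed simp
  have "qpow r (1/2) = r" "qpow r (- 1/2) = inverse r"
    using floor_of_int[of "- 1", where ?'a = rat] by (simp_all add: qpow_def power_int_minus)
  then show ?thesis
    using assms FA[of "l+1"] unfolding I_def Iel_def act_def[symmetric]
    by (subst Ipoly.simps) (simp add: act_diff act_mult act_cst FA_closed)
qed

text \<open>With p = 2i this is, up to sign, every root operator that involves two weight
  coordinates; \<open>a\<close> and \<open>b\<close> take the values q^m or \<i> q^m, or their
  inverses.\<close>

definition quad_op :: "nat \<Rightarrow> complex \<Rightarrow> complex \<Rightarrow> 'v \<Rightarrow> 'v" where
  "quad_op p a b v = I (p+2) (p-1) v + scale (a * b) (I (p+1) p v)
     - scale (r * a) (I (p+2) p v) - scale (inverse r * b) (I (p+1) (p-1) v)"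

definition short_op :: "nat \<Rightarrow> complex \<Rightarrow> 'v \<Rightarrow> 'v" where
  "short_op p a v = I (p+1) (p-1) v - scale (r * a) (I (p+1) p v)"

lemma r_nonzero: "r \<noteq> 0"
  using q_nonzero r_squared by auto

lemma short_op_eq:
  assumes "2 \<le> p" "p + 1 \<le> n" "a \<noteq> 0" "X p v = scale (E a) v"
  shows "short_op p a v = scale r (X p (X (p+1) v) - scale (E (a * q)) (X (p+1) v))"
proof -
  interpret B: Vector_Spaces.linear scale scale "X (Suc p)"
    by (rule linear_X) (use assms in auto)
  obtain p' where p': "p = Suc p'"
    using assms(1) by (cases p) auto
  have "I (p+1) (p-1) v = scale r (X p (X (p+1) v)) - scale (inverse r * E a) (X (p+1) v)"
    using I_rec[of "p-1" "p+1" v] assms B.scale by (simp add: I_simple p')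
  \<comment> \<open>This merges the coefficient from the recursion with the one in
    \<open>short_op\<close>: since r/q = 1/r, the sum [a]/r + ra is r[aq].\<close>
  moreover have "r * E (a * q) = inverse r * E a + r * a"
    unfolding E_shift(3)[OF assms(3)] using r_nonzero r_squared[symmetric]
    by (simp add: field_simps power2_eq_square)
  ultimately show ?thesis
    by (simp add: short_op_def I_simple scale_right_diff_distrib scale_left_distrib)
qed

text \<open>On a common eigenvector of \<open>X p\<close> and \<open>X (p+2)\<close> the recursion
  expresses all four terms through x, Ax, Cx and ACx, where A and C are these two operators. The
  coefficients are such that the sum factors as -(A - [aq])(C - [b/q]) x.\<close>

lemma quad_op_eq:
  assumes "2 \<le> p" "p + 2 \<le> n" "a \<noteq> 0" "b \<noteq> 0"
    and "X p v = scale (E a) v" "X (p+2) v = scale (E b) v"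
  defines "x \<equiv> X (p+1) v"
  shows "quad_op p a b v = - (X p (X (p+2) x - scale (E (b / q)) x)
      - scale (E (a * q)) (X (p+2) x - scale (E (b / q)) x))"
proof -
  interpret A: Vector_Spaces.linear scale scale "X p"
    by (rule linear_X) (use assms in auto)
  interpret B: Vector_Spaces.linear scale scale "X (Suc p)"
    by (rule linear_X) (use assms in auto)
  interpret C: Vector_Spaces.linear scale scale "X (Suc (Suc p))"
    by (rule linear_X) (use assms in auto)
  obtain p' where p': "p = Suc p'"
    using assms(1) by (cases p) auto
  have I42: "I (p+2) p u = scale r (X (p+1) (X (p+2) u)) - scale (inverse r) (X (p+2) (X (p+1) u))"
    for u
    using I_rec[of p "p+2" u] assms by (simp add: I_simple)
  have 42: "I (p+2) p v = scale (r * E b) x - scale (inverse r) (X (p+2) x)"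
    unfolding I42 using assms B.scale by simp
  have "I (p+2) p (X p v) = scale (E a) (I (p+2) p v)"
    unfolding I42 using assms A.scale B.scale C.scale
    by (simp add: scale_right_diff_distrib mult.commute mult.left_commute)
  then have 41: "I (p+2) (p-1) v = scale r (X p (I (p+2) p v)) - scale (inverse r * E a) (I (p+2) p v)"
    using I_rec[of "p-1" "p+2" v] assms by (simp add: p')
  have 31: "I (p+1) (p-1) v = scale r (X p x) - scale (inverse r * E a) x"
    using I_rec[of "p-1" "p+1" v] assms B.scale by (simp add: I_simple p')
  define w y z where "w = X p (X (p+2) x)" and "y = X p x" and "z = X (p+2) x"
  have w: "w = X p z" and 32: "I (p+1) p v = x"
    by (simp_all add: w_def z_def x_def I_simple)
  have c: "r * inverse r = 1" "r * (r * E b) = q * E b" "inverse r * E a * (r * E b) = E a * E b"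
     "inverse r * E a * inverse r = E a / q"
     "r * a * (r * E b) = q * E b * a" "r * a * inverse r = a" "inverse r * b * r = b"
     "inverse r * b * (inverse r * E a) = b * E a / q"
    using r_nonzero r_squared[symmetric] by (simp_all add: field_simps power2_eq_square)
  have "quad_op p a b v = scale (q * E b) y - w - (scale (E a * E b) x - scale (E a / q) z)
     + scale (a * b) x - (scale (q * E b * a) x - scale a z) - (scale b y - scale (b * E a / q) x)"
    unfolding quad_op_def 41 31 42 32 w y_def
    by (simp only: A.diff A.scale scale_right_diff_distrib scale_scale c scale_one
        flip: z_def)
  \<comment> \<open>The coefficient of x is minus the product of the coefficients of y and z, which
    is what makes the expression factor.\<close>
  also have "\<dots> = scale (q * E b - b) y - w + scale (E a / q + a) z
      - scale ((E a / q + a) * (q * E b - b)) x"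
    using q_nonzero by (simp add: algebra_simps)
  also have "\<dots> = - (w - scale (E (b / q)) y - scale (E (a * q)) (z - scale (E (b / q)) x))"
    unfolding E_shift(3)[OF assms(3)] E_shift(4)[OF assms(4)] by (simp add: algebra_simps)
  finally show ?thesis
    unfolding w_def y_def z_def by (simp add: A.diff A.scale)
qed

section \<open>Root operators map weight vectors to weight vectors\<close>

lemma short_op_eigenvector:
  assumes "2 \<le> p" "p + 1 \<le> n" "a \<noteq> 0" "X p v = scale (E a) v"
  shows "X p (short_op p a v) = scale (E (a / q)) (short_op p a v)"
proof -
  interpret A: Vector_Spaces.linear scale scale "X p"
    by (rule linear_X) (use assms in auto)
  have "X p (X p (X (p+1) v) - scale (E (a * q)) (X (p+1) v))
      = scale (E (a / q)) (X p (X (p+1) v) - scale (E (a * q)) (X (p+1) v))"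
    by (rule eigenvector_of_quadratic[OF A.linear_axioms]) (rule X_quadratic; use assms in simp)
  then show ?thesis
    unfolding short_op_eq[OF assms] A.scale by (simp add: mult.commute)
qed

lemma quad_op_eigenvector:
  assumes "2 \<le> p" "p + 2 \<le> n" "a \<noteq> 0" "b \<noteq> 0"
    and "X p v = scale (E a) v" "X (p+2) v = scale (E b) v"
  shows "X p (quad_op p a b v) = scale (E (a / q)) (quad_op p a b v)"
    and "X (p+2) (quad_op p a b v) = scale (E (b * q)) (quad_op p a b v)"
proof -
  interpret A: Vector_Spaces.linear scale scale "X p"
    by (rule linear_X) (use assms in auto)
  interpret C: Vector_Spaces.linear scale scale "X (p+2)"
    by (rule linear_X) (use assms in auto)
  define x where "x = X (p+1) v"
  have AC: "X p (X (p+2) u) = X (p+2) (X p u)" for u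
    by (rule X_commute) (use assms in auto)
  have Ax: "X p (X p x) = scale (E (a * q) + E (a / q)) (X p x) - scale (E (a * q) * E (a / q)) x"
    unfolding x_def by (rule X_quadratic) (use assms in auto)
  have "X (p+2) (X (p+2) x) =
      scale (E (b * q) + E (b / q)) (X (p+2) x) - scale (E (b * q) * E (b / q)) x"
    unfolding x_def by (rule X_quadratic) (use assms in auto)
  then have Cx: "X (p+2) (X (p+2) x - scale (E (b / q)) x) =
      scale (E (b * q)) (X (p+2) x - scale (E (b / q)) x)"
    by (intro eigenvector_of_quadratic[OF C.linear_axioms]) (simp add: ac_simps)
  define z where "z = X (p+2) x - scale (E (b / q)) x"
  \<comment> \<open>Since A and C commute, the quadratic relation for A passes from x to z, so the
    factor A - [aq] can be applied after C - [b/q].\<close>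
  have Az: "X p (X p z) = scale (E (a * q) + E (a / q)) (X p z) - scale (E (a * q) * E (a / q)) z"
    unfolding z_def A.diff A.scale AC Ax C.diff C.scale by (simp add: algebra_simps)
  have eq: "quad_op p a b v = - (X p z - scale (E (a * q)) z)"
    unfolding z_def x_def by (rule quad_op_eq[OF assms])
  show "X p (quad_op p a b v) = scale (E (a / q)) (quad_op p a b v)"
    unfolding eq A.neg eigenvector_of_quadratic[OF A.linear_axioms Az]
    by (rule scale_minus_right[symmetric])
  have "X (p+2) z = scale (E (b * q)) z"
    unfolding z_def by (rule Cx)
  then show "X (p+2) (quad_op p a b v) = scale (E (b * q)) (quad_op p a b v)"
    unfolding eq C.neg C.diff C.scale AC[symmetric]
    by (simp add: A.scale scale_right_diff_distrib mult.commute)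
qed

text \<open>The factored form contains only \<open>X p\<close> and \<open>X (p+1)\<close>, and both
  index gaps exceed 1, so \<open>X j\<close> passes through to \<open>v\<close>.\<close>

lemma short_op_commute:
  assumes "2 \<le> p" "p + 1 \<le> n" "a \<noteq> 0" "X p v = scale (E a) v"
    and "j \<in> {2..n}" "\<bar>int j - int p\<bar> > 1" "\<bar>int j - int (p+1)\<bar> > 1" "X j v = scale e v"
  shows "X j (short_op p a v) = scale e (short_op p a v)"
proof -
  interpret A: Vector_Spaces.linear scale scale "X p"
    by (rule linear_X) (use assms in auto)
  interpret B: Vector_Spaces.linear scale scale "X (p+1)"
    by (rule linear_X) (use assms in auto)
  interpret J: Vector_Spaces.linear scale scale "X j"
    by (rule linear_X) fact
  have comm: "X j (X p u) = X p (X j u)" "X j (X (p+1) u) = X (p+1) (X j u)" for u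
    by (rule X_commute; use assms in auto)+
  show ?thesis
    unfolding short_op_eq[OF assms(1-4)] J.scale J.diff comm assms(8) A.scale B.scale
    by (simp add: scale_right_diff_distrib mult.commute mult.left_commute)
qed

lemma quad_op_commute:
  assumes "2 \<le> p" "p + 2 \<le> n" "a \<noteq> 0" "b \<noteq> 0"
    and "X p v = scale (E a) v" "X (p+2) v = scale (E b) v"
    and "j \<in> {2..n}" "\<bar>int j - int p\<bar> > 1" "\<bar>int j - int (p+1)\<bar> > 1" "\<bar>int j - int (p+2)\<bar> > 1"
      "X j v = scale e v"
  shows "X j (quad_op p a b v) = scale e (quad_op p a b v)"
proof -
  interpret A: Vector_Spaces.linear scale scale "X p"
    by (rule linear_X) (use assms in auto)
  interpret B: Vector_Spaces.linear scale scale "X (p+1)"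
    by (rule linear_X) (use assms in auto)
  interpret C: Vector_Spaces.linear scale scale "X (p+2)"
    by (rule linear_X) (use assms in auto)
  interpret J: Vector_Spaces.linear scale scale "X j"
    by (rule linear_X) fact
  have comm: "X j (X p u) = X p (X j u)" "X j (X (p+1) u) = X (p+1) (X j u)"
    "X j (X (p+2) u) = X (p+2) (X j u)" for u
    by (rule X_commute; use assms in auto)+
  show ?thesis
    unfolding quad_op_eq[OF assms(1-6)] J.scale J.diff J.neg comm assms(11)
      A.scale B.scale C.scale A.diff
    by (simp add: scale_right_diff_distrib mult.commute mult.left_commute)
qed

lemma weight_vector_iff:
  "weight_vector ty n q r scale T m v \<longleftrightarrow> (\<forall>j \<in> {1..n div 2}. m j \<in> weight_coords ty \<and>
     v \<noteq> 0 \<and> X (2*j) v = scale (eigval ty r (m j)) v)"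
proof -
  have "T (Iel n q r (2*j) (2*j-1)) = X (2*j)" if "1 \<le> j" for j
    using that I_simple[of "2*j-1"] by (simp add: I_def[abs_def])
  then show ?thesis
    by (auto simp: weight_vector_def is_eigenvector_def)
qed

text \<open>Keeping \<open>a\<close>, \<open>b\<close>, \<open>m'\<close> and the scalar
  \<open>c\<close> free lets one statement serve raising and lowering, both types, and all
  signs.\<close>

lemma quad_op_weight_vector:
  assumes v: "weight_vector ty n q r scale T m v" and i: "1 \<le> i" "2 * i + 2 \<le> n"
    and ab: "a \<noteq> 0" "b \<noteq> 0" "E a = eigval ty r (m i)" "E b = eigval ty r (m (i+1))"
    and m': "E (a / q) = eigval ty r (m' i)" "E (b * q) = eigval ty r (m' (i+1))"
      "\<And>j. j \<noteq> i \<Longrightarrow> j \<noteq> i+1 \<Longrightarrow> m' j = m j"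
      "m' i \<in> weight_coords ty" "m' (i+1) \<in> weight_coords ty"
    and w: "w = scale c (quad_op (2*i) a b v)"
  shows "\<exists>\<beta> w'. w = scale \<beta> w' \<and> (\<beta> = 0 \<or> weight_vector ty n q r scale T m' w')"
proof (cases "quad_op (2*i) a b v = 0")
  case True
  \<comment> \<open>A weight vector is nonzero, so a vanishing image is recorded by the coefficient
    0.\<close>
  then show ?thesis
    using w by (intro exI[of _ 0]) simp
next
  case False
  have A: "2 \<le> 2 * i" "2 * i + 2 \<le> n" "a \<noteq> 0" "b \<noteq> 0"
    "X (2*i) v = scale (E a) v" "X (2*i+2) v = scale (E b) v"
    using v i ab unfolding weight_vector_iff
    by (auto dest: bspec[where x=i] bspec[where x="i+1"])
  have "m' j \<in> weight_coords ty \<and> X (2*j) (quad_op (2*i) a b v) =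
      scale (eigval ty r (m' j)) (quad_op (2*i) a b v)" if j: "j \<in> {1..n div 2}" for j
  proof -
    consider "j = i" | "j = i + 1" | "j \<noteq> i" "j \<noteq> i + 1" by blast
    then show ?thesis
    proof cases
      case 3
      \<comment> \<open>The even index 2j lies at distance at least 3 from 2i+1, and at least 2 from
        2i and 2i+2.\<close>
      then show ?thesis
        using quad_op_commute[OF A, of "2*j"] j v m'(3) unfolding weight_vector_iff by auto
    qed (use quad_op_eigenvector[OF A] m' in auto)
  qed
  then have "weight_vector ty n q r scale T m' (quad_op (2*i) a b v)"
    unfolding weight_vector_iff using False by blast
  then show ?thesis
    using w by blast
qed

lemma short_op_weight_vector:
  assumes v: "weight_vector ty n q r scale T m v" and i: "1 \<le> i" "n = 2 * i + 1"
    and a: "a \<noteq> 0" "E a = eigval ty r (m i)"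
    and m': "E (a / q) = eigval ty r (m' i)"
      "\<And>j. j \<noteq> i \<Longrightarrow> m' j = m j" "m' i \<in> weight_coords ty"
  shows "\<exists>\<beta> w'. short_op (2*i) a v = scale \<beta> w' \<and>
    (\<beta> = 0 \<or> weight_vector ty n q r scale T m' w')"
proof (cases "short_op (2*i) a v = 0")
  case True
  then show ?thesis
    by (intro exI[of _ 0]) simp
next
  case False
  have A: "2 \<le> 2 * i" "2 * i + 1 \<le> n" "a \<noteq> 0" "X (2*i) v = scale (E a) v"
    using v i a unfolding weight_vector_iff by (auto dest: bspec[where x=i])
  have "m' j \<in> weight_coords ty \<and> X (2*j) (short_op (2*i) a v) =
      scale (eigval ty r (m' j)) (short_op (2*i) a v)" if j: "j \<in> {1..n div 2}" for j
  proof (cases "j = i")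
    case True
    then show ?thesis
      using short_op_eigenvector[OF A] m' by auto
  next
    case False
    then show ?thesis
      using short_op_commute[OF A, of "2*j"] j i v m'(2) unfolding weight_vector_iff by auto
  qed
  then have "weight_vector ty n q r scale T m' (short_op (2*i) a v)"
    unfolding weight_vector_iff using False by blast
  then show ?thesis
    by (intro exI[of _ 1] exI[of _ "short_op (2*i) a v"]) simp
qed

end

section \<open>Half-integral powers of q and the eigenvalues of the two types\<close>

lemma qpow_add:
  assumes "r \<noteq> 0" "x \<in> half_ints"
  shows "qpow r (x + y) = qpow r x * qpow r y"
proof -
  obtain z :: int where z: "2 * x = of_int z"
    using assms(2) by (auto simp: half_ints_def elim: Ints_cases)
  then have "\<lfloor>2 * (x + y)\<rfloor> = z + \<lfloor>2 * y\<rfloor>"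
    by (simp add: distrib_left)
  then show ?thesis
    using assms(1) z by (simp add: qpow_def power_int_add)
qed

lemma qpow_minus:
  assumes "r \<noteq> 0" "x \<in> half_ints"
  shows "qpow r (- x) = inverse (qpow r x)"
proof -
  have "qpow r x * qpow r (- x) = 1"
    using qpow_add[OF assms, of "- x"] by (simp add: qpow_def)
  then show ?thesis
    by (metis inverse_unique)
qed

lemma qpow_diff:
  assumes "r \<noteq> 0" "x \<in> half_ints" "y \<in> half_ints"
  shows "qpow r (x - y) = qpow r x * inverse (qpow r y)"
  using qpow_add[OF assms(1,2), of "- y"] qpow_minus[OF assms(1,3)] by simp

lemma qpow_numerals:
  "qpow r (1/2) = r" "qpow r 1 = r\<^sup>2" "qpow r (- 1) = inverse (r\<^sup>2)" "qpow r (- (1/2)) = inverse r"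
  using floor_of_int[of "- 1", where ?'a = rat] floor_of_int[of "- 2", where ?'a = rat]
  by (simp_all add: qpow_def power_int_minus)

lemma half_ints_closed:
  "1 \<in> half_ints" "1/2 \<in> half_ints"
  "x \<in> half_ints \<Longrightarrow> - x \<in> half_ints"
  "x \<in> half_ints \<Longrightarrow> y \<in> half_ints \<Longrightarrow> x + y \<in> half_ints"
  "x \<in> half_ints \<Longrightarrow> y \<in> half_ints \<Longrightarrow> x - y \<in> half_ints"
  by (auto simp: half_ints_def distrib_left right_diff_distrib)

lemma weight_coords_shift:
  assumes "x \<in> weight_coords ty"
  shows "x \<in> half_ints" "x + 1 \<in> weight_coords ty" "x - 1 \<in> weight_coords ty"
proof -
  have "x + 1 \<in> \<int> \<longleftrightarrow> x \<in> \<int>" "x - 1 \<in> \<int> \<longleftrightarrow> x \<in> \<int>"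
    by (metis Ints_1 Ints_add Ints_diff add_diff_cancel_right' diff_add_cancel)+
  then show "x \<in> half_ints" "x + 1 \<in> weight_coords ty" "x - 1 \<in> weight_coords ty"
    using assms half_ints_closed by (cases ty; auto)+
qed

fun weight_base :: "rep_type \<Rightarrow> complex \<Rightarrow> rat \<Rightarrow> complex" where
  "weight_base Classical r m = \<i> * qpow r m"
| "weight_base Nonclassical r m = qpow r m"

lemma weight_base_nonzero: "weight_base ty r m \<noteq> 0" if "r \<noteq> 0"
  using that by (cases ty) (auto simp: qpow_def)

lemma eigval_weight_base:
  assumes "r \<noteq> 0" "r\<^sup>2 = q" "m \<in> half_ints"
  shows "sym_eig q (weight_base ty r m) = eigval ty r m"
  using assms
  by (cases ty) (simp_all add: sym_eig_def qnum_def qnum_plus_def qpow_minus qpow_numerals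
      right_diff_distrib)

text \<open>Multiplying u by q raises the weight by 1. As [u] is invariant under inversion, the
  direction reverses when u is replaced by its inverse; this is how one operator shape yields both
  raising and lowering.\<close>

lemma eigval_shift:
  fixes ty :: rep_type
  assumes "r \<noteq> 0" "r\<^sup>2 = q" "m \<in> half_ints"
  defines "u \<equiv> weight_base ty r m"
  shows "sym_eig q (u * q) = eigval ty r (m + 1)" "sym_eig q (u / q) = eigval ty r (m - 1)"
    "sym_eig q (inverse u / q) = eigval ty r (m + 1)"
    "sym_eig q (inverse u * q) = eigval ty r (m - 1)"
proof -
  have "weight_base ty r (m + 1) = u * q" "weight_base ty r (m - 1) = u / q"
    unfolding u_def using qpow_add[OF assms(1,3), of 1] qpow_add[OF assms(1,3), of "- 1"] assms(2)
    by (cases ty; simp add: qpow_numerals divide_inverse)+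
  then show 1: "sym_eig q (u * q) = eigval ty r (m + 1)"
    "sym_eig q (u / q) = eigval ty r (m - 1)"
    using eigval_weight_base[OF assms(1,2)] half_ints_closed assms(3) by metis+
  show "sym_eig q (inverse u / q) = eigval ty r (m + 1)"
    "sym_eig q (inverse u * q) = eigval ty r (m - 1)"
    using sym_eig_inverse[of q "u * q"] sym_eig_inverse[of q "u / q"] 1
    by (simp_all add: divide_inverse)
qed

section \<open>Identification of the raising and lowering operators with the two shapes\<close>

context uqso_rep
begin

lemmas op_simps = I_def quad_op_def short_op_def Let_def qpow_add qpow_diff qpow_minus qpow_numerals
  half_ints_closed r_nonzero

text \<open>Here a and b are both inverted or both not. In the classical type their factors \<i> or
  -\<i> multiply to -1, which accounts for the sign.\<close>

lemma raising_lowering_op_eq: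
  assumes "m i \<in> half_ints" "m (i+1) \<in> half_ints" "i < n div 2"
  shows "raising_op ty n q r scale T m i v =
    scale (if ty = Classical then - 1 else 1)
      (quad_op (2*i) (inverse (weight_base ty r (m i))) (inverse (weight_base ty r (m (i+1)))) v)"
    and "lowering_op ty n q r scale T m i v =
    scale (if ty = Classical then - 1 else 1)
      (quad_op (2*i) (weight_base ty r (m i)) (weight_base ty r (m (i+1))) v)"
  using assms
  by - (cases ty; simp add: raising_op_def lowering_op_def op_simps ac_simps)+

text \<open>Exactly one of a and b is inverted, so the factors \<i> cancel in ab and the sign is the
  same for both types. Writing the last index as \<open>i+1\<close> avoids truncated
  subtraction.\<close>

lemma raising_lowering_op_last_even_eq:
  assumes "m i \<in> half_ints" "m (i+1) \<in> half_ints" "n = 2 * (i+1)"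
  shows "raising_op ty n q r scale T m (i+1) v =
      quad_op (2*i) (inverse (weight_base ty r (m i))) (weight_base ty r (m (i+1))) v"
    and "lowering_op ty n q r scale T m (i+1) v =
      scale (- 1) (quad_op (2*i) (weight_base ty r (m i)) (inverse (weight_base ty r (m (i+1)))) v)"
proof -
  have k: "n div 2 = i + 1"
    using assms(3) by simp
  note defs = raising_op_def lowering_op_def Let_def k if_P[OF assms(3)]
  show "raising_op ty n q r scale T m (i+1) v =
      quad_op (2*i) (inverse (weight_base ty r (m i))) (weight_base ty r (m (i+1))) v"
    unfolding defs using assms(1,2) by (cases ty; simp add: op_simps ac_simps)
  show "lowering_op ty n q r scale T m (i+1) v =
      scale (- 1) (quad_op (2*i) (weight_base ty r (m i)) (inverse (weight_base ty r (m (i+1)))) v)"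
    unfolding defs using assms(1,2) by (cases ty; simp add: op_simps ac_simps)
qed

lemma raising_lowering_op_last_odd_eq:
  assumes "m i \<in> half_ints" "n = 2 * i + 1"
  shows "raising_op ty n q r scale T m i v = short_op (2*i) (inverse (weight_base ty r (m i))) v"
    and "lowering_op ty n q r scale T m i v = short_op (2*i) (weight_base ty r (m i)) v"
proof -
  have k: "n div 2 = i" "n \<noteq> 2 * i"
    using assms(2) by simp_all
  show "raising_op ty n q r scale T m i v = short_op (2*i) (inverse (weight_base ty r (m i))) v"
    using assms(1) k by (cases ty; simp add: raising_op_def op_simps ac_simps)
  show "lowering_op ty n q r scale T m i v = short_op (2*i) (weight_base ty r (m i)) v"
    using assms(1) k by (cases ty; simp add: lowering_op_def op_simps ac_simps)
qed

end

section \<open>Case distinction over the simple roots\<close>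

theorem mainTheorem4:
  fixes n k i :: nat
    and q r :: complex
    and scale :: "complex \<Rightarrow> 'v::ab_group_add \<Rightarrow> 'v"
    and T :: "ncpoly set \<Rightarrow> 'v \<Rightarrow> 'v"
    and ty :: rep_type
    and m :: "nat \<Rightarrow> rat"
    and v :: 'v
  assumes "n \<ge> 3" and "n = 2 * k \<or> n = 2 * k + 1"
    and "q \<noteq> 0" and "\<And>d::nat. d > 0 \<Longrightarrow> q ^ d \<noteq> 1"
    and "r\<^sup>2 = q"
    and "vector_space scale" and "finite_dim scale"
    and "irreducible_rep n q scale T"
    and "of_type ty n q r scale T"
    and "weight_vector ty n q r scale T m v"
    and "i \<in> {1..k}"
  shows "(\<exists>\<beta> w. raising_op ty n q r scale T m i v = scale \<beta> w \<and>
            (\<beta> = 0 \<or> weight_vector ty n q r scale T (\<lambda>j. m j + simple_root n i j) w)) \<and>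
         (\<exists>\<gamma> w. lowering_op ty n q r scale T m i v = scale \<gamma> w \<and>
            (\<gamma> = 0 \<or> weight_vector ty n q r scale T (\<lambda>j. m j - simple_root n i j) w))"
proof -
  have "q\<^sup>2 \<noteq> 1"
    using assms(4)[of 2] by simp
  interpret vector_space scale by fact
  interpret uqso_rep scale n q r T
    using assms(3,5,8) \<open>q\<^sup>2 \<noteq> 1\<close> by unfold_locales (auto simp: irreducible_rep_def)
  have k: "n div 2 = k"
    using assms(2) by auto
  note v = assms(10)
  let ?u = "\<lambda>j. weight_base ty r (m j)"
  have mj: "m j \<in> half_ints" "m j + 1 \<in> weight_coords ty" "m j - 1 \<in> weight_coords ty"
    if "j \<in> {1..k}" for j
    using v that weight_coords_shift[of "m j" ty] unfolding weight_vector_def k by blast+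
  have u: "?u j \<noteq> 0" "inverse (?u j) \<noteq> 0" for j
    using weight_base_nonzero[OF r_nonzero] by simp_all
  have E: "E (?u j) = eigval ty r (m j)" "E (inverse (?u j)) = eigval ty r (m j)"
    "E (?u j * q) = eigval ty r (m j + 1)" "E (?u j / q) = eigval ty r (m j - 1)"
    "E (inverse (?u j) / q) = eigval ty r (m j + 1)"
    "E (inverse (?u j) * q) = eigval ty r (m j - 1)" if "j \<in> {1..k}" for j
    using eigval_weight_base[OF r_nonzero r_squared] eigval_shift[OF r_nonzero r_squared]
      mj(1)[OF that] by (simp_all add: sym_eig_inverse)
  \<comment> \<open>In the middle case l = k - 1, which is at least 1 because n = 2k and n \<ge>
    3.\<close>
  consider "i < k" | l where "i = l + 1" "n = 2 * (l + 1)" "1 \<le> l" | "n = 2 * i + 1"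
  proof (cases "i < k")
    case False
    then have "i = k" using assms(11) by simp
    then show ?thesis
      using assms(1,2,11) that(2)[of "k - 1"] that(3) by auto
  qed
  then show ?thesis
  proof cases
    case 1
    then have mem: "i \<in> {1..k}" "i + 1 \<in> {1..k}" and i: "1 \<le> i" "2 * i + 2 \<le> n"
      using assms(2,11) by auto
    have root: "simple_root n i = (\<lambda>j. unit_weight i j - unit_weight (i+1) j)"
      using 1 k by (simp add: simple_root_def Let_def)
    note eq = raising_lowering_op_eq[where i=i and m=m,
        OF mj(1)[OF mem(1)] mj(1)[OF mem(2)], unfolded k, OF 1]
    \<comment> \<open>Unifying the last premise with \<open>eq\<close> fixes a, b and c; the other
      premises are then instances of \<open>E\<close> and of the closure of weight coordinates under
      shifts.\<close>
    show ?thesis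
      using mj[OF mem(1)] mj[OF mem(2)] E[OF mem(1)] E[OF mem(2)] u unfolding root
      by (intro conjI quad_op_weight_vector[OF v i _ _ _ _ _ _ _ _ _ eq(1)]
          quad_op_weight_vector[OF v i _ _ _ _ _ _ _ _ _ eq(2)])
        (simp_all add: unit_weight_def)
  next
    case 2
    then have mem: "l \<in> {1..k}" "l + 1 \<in> {1..k}" and l: "1 \<le> l" "2 * l + 2 \<le> n"
      using assms(2,11) by auto
    have root: "simple_root n i = (\<lambda>j. unit_weight l j + unit_weight (l+1) j)"
      using 2 by (simp add: simple_root_def Let_def)
    note eq = raising_lowering_op_last_even_eq[where i=l and m=m,
        OF mj(1)[OF mem(1)] mj(1)[OF mem(2)] 2(2)]
    \<comment> \<open>The raising operator carries no sign here, so the scalar c = 1 is inserted to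
      fit the premise.\<close>
    note eq1 = trans[OF eq(1) scale_one[symmetric]]
    show ?thesis
      using mj[OF mem(1)] mj[OF mem(2)] E[OF mem(1)] E[OF mem(2)] u unfolding root unfolding 2(1)
      by (intro conjI quad_op_weight_vector[OF v l _ _ _ _ _ _ _ _ _ eq1]
          quad_op_weight_vector[OF v l _ _ _ _ _ _ _ _ _ eq(2)])
        (simp_all add: unit_weight_def)
  next
    case 3
    then have i: "1 \<le> i"
      using assms(11) by simp
    have root: "simple_root n i = unit_weight i"
      using 3 by (simp add: simple_root_def Let_def)
    show ?thesis
      using mj[OF assms(11)] E[OF assms(11)] u
      unfolding root
        raising_lowering_op_last_odd_eq[where i=i and m=m, OF mj(1)[OF assms(11)] 3]
      by (intro conjI short_op_weight_vector[OF v i 3]) (simp_all add: unit_weight_def)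
  qed
qed

end
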